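(* Let $w>0$, let $n\geq 3$ be odd, and let $P\subset H^2$ be an ordinary reduced $n$-gon of minimal width (thickness) $w$, with associated angles $\varphi_1,\dots,\varphi_n$. Then $$ \operatorname{perim}(P)=2\sum_{i=1}^n p_w(\varphi_i), $$ where $$ g_w(x)=\frac{1+\cos x-\sqrt{(1+\cos x)^2-4\tanh^2 w\,\cos x}}{2\tanh w}, \qquad p_w(x)=\operatorname{arcosh}\left(\frac{1-g_w(x)\tanh w}{\sqrt{1-\tanh^2 w}}\right). $$
   Context: $H^2$ is the hyperbolic plane (constant curvature $-1$) with geodesic distance $d$. A set is convex if it contains the geodesic segment joining any two of its points; a convex body is a compact convex set with non-empty interior; a polygon is a convex body that is the convex hull of finitely many points, and a $k$-gon is a polygon with $k$ vertices (a vertex is a point of the generating set not in the convex hull of the others). $\operatorname{perim}(P)$ is the sum of the lengths of the sides of $P$. Width: a line $\ell$ is a supporting line of a convex body $K$ if $K\cap\ell\neq\emptyset$ and $K$ lies in one of the closed half-planes bounded by $\ell$. The width of $K$ with respect to a supporting line $\ell$ is the distance between $\ell$ and a most distant supporting line $\ell'$ of $K$ from $\ell$. The minimal width (thickness) $w(K)$ is the minimum of the width over all supporting lines. Ordinary reduced polygon: let $n\ge 3$ be odd and let $P$ be a convex $n$-gon in $H^2$ with vertices $v_1,\dots,v_n$ in positively oriented cyclic order (indices mod $n$). The side opposite to $v_i$ is $[v_{i+\frac{n-1}{2}},v_{i+\frac{n+1}{2}}]$. $P$ of minimal width $w$ is called an ordinary reduced polygon if for every $i$ the distance of $v_i$ from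 its opposite side is $w$ and the orthogonal projection of $v_i$ onto the line of the opposite side lies in the relative interior of that side. Angles: let $t_i$ be the orthogonal projection of $v_i$ onto the line through $v_{i+\frac{n-1}{2}}$ and $v_{i+\frac{n+1}{2}}$. The geodesic segments $[v_i,t_i]$ and $[v_{i+\frac{n+1}{2}},t_{i+\frac{n+1}{2}}]$ intersect in a point $p_i$. Writing $\angle(a,b,c)$ for the angle at $b$ between the segments $[b,a]$ and $[b,c]$, define $\varphi_i=\angle(v_i,p_i,t_{i+\frac{n+1}{2}})=\angle(t_i,p_i,v_{i+\frac{n+1}{2}})$. *)

theory Defs
  imports "HOL-Analysis.Analysis"
begin

text \<open>Hyperboloid model of the plane of constant curvature \<open>-1\<close>: the upper sheet of
  \<open>lorentz x x = -1\<close> in Minkowski 3-space. The topology used for compactness and interiors is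
  the one induced by the geodesic distance.\<close>

definition lorentz :: "real^3 \<Rightarrow> real^3 \<Rightarrow> real" where
  "lorentz x y = x$1 * y$1 + x$2 * y$2 - x$3 * y$3"

typedef hyp2 = "{x :: real^3. lorentz x x = -1 \<and> x$3 > 0}"
  morphisms coords Abs_hyp2
proof
  show "vector [0, 0, 1] \<in> {x :: real^3. lorentz x x = -1 \<and> x$3 > 0}"
    by (simp add: lorentz_def)
qed

lemma lorentz_coords_self: "lorentz (coords x) (coords x) = -1"
  and coords_3_pos: "coords x $ 3 > 0"
  using coords[of x] by auto

lemma lorentz_commute: "lorentz x y = lorentz y x"
  by (simp add: lorentz_def mult.commute)

lemma lorentz_coords_identity:
  fixes x y :: hyp2
  shows "(coords x $ 3 * coords y $ 3)\<^sup>2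
     = (coords x $ 1 * coords y $ 1 + coords x $ 2 * coords y $ 2 + 1)\<^sup>2
     + ((coords x $ 1 - coords y $ 1)\<^sup>2 + (coords x $ 2 - coords y $ 2)\<^sup>2
        + (coords x $ 1 * coords y $ 2 - coords x $ 2 * coords y $ 1)\<^sup>2)"
proof -
  have "(coords x $ 3)\<^sup>2 = 1 + (coords x $ 1)\<^sup>2 + (coords x $ 2)\<^sup>2"
       "(coords y $ 3)\<^sup>2 = 1 + (coords y $ 1)\<^sup>2 + (coords y $ 2)\<^sup>2"
    using lorentz_coords_self[of x] lorentz_coords_self[of y]
    by (simp_all add: lorentz_def power2_eq_square)
  then show ?thesis
    unfolding power_mult_distrib by (simp only:) (simp add: power2_eq_square algebra_simps)
qed

lemma lorentz_coords_le: "lorentz (coords x) (coords y) \<le> -1"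
proof -
  have "(coords x $ 1 * coords y $ 1 + coords x $ 2 * coords y $ 2 + 1)\<^sup>2
      \<le> (coords x $ 3 * coords y $ 3)\<^sup>2"
    unfolding lorentz_coords_identity by simp
  then have "coords x $ 1 * coords y $ 1 + coords x $ 2 * coords y $ 2 + 1
      \<le> coords x $ 3 * coords y $ 3"
    by (rule power2_le_imp_le) (simp add: coords_3_pos less_imp_le)
  then show ?thesis by (simp add: lorentz_def)
qed

lemma lorentz_coords_eq_iff: "lorentz (coords x) (coords y) = -1 \<longleftrightarrow> x = y"
proof
  assume "lorentz (coords x) (coords y) = -1"
  then have "coords x $ 1 * coords y $ 1 + coords x $ 2 * coords y $ 2 + 1
      = coords x $ 3 * coords y $ 3"
    by (simp add: lorentz_def)
  then have "(coords x $ 1 - coords y $ 1)\<^sup>2 + (coords x $ 2 - coords y $ 2)\<^sup>2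
        + (coords x $ 1 * coords y $ 2 - coords x $ 2 * coords y $ 1)\<^sup>2 = 0"
    using lorentz_coords_identity[of x y] by simp
  then have e12: "coords x $ 1 = coords y $ 1" "coords x $ 2 = coords y $ 2"
    by (smt (verit) power2_less_eq_zero_iff zero_le_power2 right_minus_eq)+
  then have "(coords x $ 3)\<^sup>2 = (coords y $ 3)\<^sup>2"
    using lorentz_coords_self[of x] lorentz_coords_self[of y]
    by (simp add: lorentz_def power2_eq_square)
  then have "coords x $ 3 = coords y $ 3"
    using coords_3_pos[of x] coords_3_pos[of y] by (simp add: power2_eq_iff_nonneg)
  with e12 have "coords x = coords y"
    by (simp add: vec_eq_iff forall_3)
  then show "x = y" by (simp add: coords_inject)
qed (simp add: lorentz_coords_self)

lemma lorentz_gram: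
  "(lorentz x x * lorentz y y * lorentz z z + 2 * lorentz x y * lorentz y z * lorentz x z
    - lorentz x x * (lorentz y z)\<^sup>2 - lorentz y y * (lorentz x z)\<^sup>2 - lorentz z z * (lorentz x y)\<^sup>2)
   = - (det (vector [x, y, z] :: real^3^3))\<^sup>2"
  unfolding lorentz_def det_3 vector_3 power2_eq_square by algebra

lemma lorentz_triangle:
  defines "B \<equiv> \<lambda>x y. - lorentz (coords x) (coords y)"
  shows "arcosh (B x z) \<le> arcosh (B x y) + arcosh (B y z)"
proof -
  have ge1: "B a b \<ge> 1" for a b
    using lorentz_coords_le[of a b] by (simp add: B_def)
  have "0 \<le> (det (vector [coords x, coords y, coords z] :: real^3^3))\<^sup>2" by simp
  also have "\<dots> = 1 + 2 * B x y * B y z * B x z - (B y z)\<^sup>2 - (B x z)\<^sup>2 - (B x y)\<^sup>2"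
    using lorentz_gram[of "coords x" "coords y" "coords z"]
    by (simp add: lorentz_coords_self B_def algebra_simps)
  finally have sq: "(B x z - B x y * B y z)\<^sup>2 \<le> ((B x y)\<^sup>2 - 1) * ((B y z)\<^sup>2 - 1)"
    by (simp add: power2_eq_square algebra_simps)
  have c: "cosh (arcosh (B a b)) = B a b" for a b
    using ge1[of a b] by simp
  have s: "sinh (arcosh (B a b)) \<ge> 0" for a b
    using arcosh_nonneg_real[OF ge1[of a b]] by simp
  have s2: "(sinh (arcosh (B a b)))\<^sup>2 = (B a b)\<^sup>2 - 1" for a b
    using hyperbolic_pythagoras[of "arcosh (B a b)"] c[of a b] by simp
  have "B x z - B x y * B y z \<le> sinh (arcosh (B x y)) * sinh (arcosh (B y z))"
  proof (rule power2_le_imp_le)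
    show "(B x z - B x y * B y z)\<^sup>2 \<le> (sinh (arcosh (B x y)) * sinh (arcosh (B y z)))\<^sup>2"
      using sq by (simp add: power_mult_distrib s2)
  qed (intro mult_nonneg_nonneg s)
  then have "cosh (arcosh (B x z)) \<le> cosh (arcosh (B x y) + arcosh (B y z))"
    by (simp add: cosh_add c)
  then show ?thesis
    using cosh_real_nonneg_le_iff[of "arcosh (B x z)" "arcosh (B x y) + arcosh (B y z)"]
      arcosh_nonneg_real[OF ge1] by (simp add: add_nonneg_nonneg)
qed

instantiation hyp2 :: metric_space
begin

definition dist_hyp2 :: "hyp2 \<Rightarrow> hyp2 \<Rightarrow> real" where
  "dist_hyp2 x y = arcosh (- lorentz (coords x) (coords y))"

definition uniformity_hyp2 :: "(hyp2 \<times> hyp2) filter" where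
  "uniformity_hyp2 = (INF e\<in>{0<..}. principal {(x, y). dist x y < e})"

definition open_hyp2 :: "hyp2 set \<Rightarrow> bool" where
  "open_hyp2 U \<longleftrightarrow> (\<forall>x\<in>U. eventually (\<lambda>(x', y). x' = x \<longrightarrow> y \<in> U) uniformity)"

instance
proof
  fix x y z :: hyp2
  show "dist x y = 0 \<longleftrightarrow> x = y"
  proof
    assume "dist x y = 0"
    then have "cosh (arcosh (- lorentz (coords x) (coords y))) = 1"
      by (simp add: dist_hyp2_def)
    then have "lorentz (coords x) (coords y) = -1"
      using lorentz_coords_le[of x y] by simp
    then show "x = y" by (simp add: lorentz_coords_eq_iff)
  qed (simp add: dist_hyp2_def lorentz_coords_self)
  show "dist x y \<le> dist x z + dist y z"
    using lorentz_triangle[of x y z] by (simp add: dist_hyp2_def lorentz_commute)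
qed (simp_all only: uniformity_hyp2_def open_hyp2_def)

end

definition geo_segment :: "hyp2 \<Rightarrow> hyp2 \<Rightarrow> hyp2 set" where
  "geo_segment x y = {z. dist x z + dist z y = dist x y}"

definition open_geo_segment :: "hyp2 \<Rightarrow> hyp2 \<Rightarrow> hyp2 set" where
  "open_geo_segment x y = geo_segment x y - {x, y}"

text \<open>Geodesic lines of the hyperboloid are its sections with the planes \<open>n\<^sup>\<bottom>\<close> for a
  spacelike normal \<open>n\<close>. The two closed half-planes bounded by \<open>normal_line n\<close> are
  \<open>normal_halfplane n\<close> and \<open>normal_halfplane (-n)\<close>.\<close>

definition normal_line :: "real^3 \<Rightarrow> hyp2 set" where
  "normal_line n = {x. lorentz n (coords x) = 0}"

definition normal_halfplane :: "real^3 \<Rightarrow> hyp2 set" where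
  "normal_halfplane n = {x. lorentz n (coords x) \<ge> 0}"

definition is_line :: "hyp2 set \<Rightarrow> bool" where
  "is_line l \<longleftrightarrow> (\<exists>n. lorentz n n > 0 \<and> l = normal_line n)"

definition line_through :: "hyp2 \<Rightarrow> hyp2 \<Rightarrow> hyp2 set" where
  "line_through a b = (THE l. is_line l \<and> a \<in> l \<and> b \<in> l)"

text \<open>For \<open>a \<noteq> b\<close>, \<open>tangent_to b a\<close> is a tangent vector at \<open>b\<close> (i.e. Lorentz orthogonal to
  \<open>coords b\<close>) pointing along the geodesic from \<open>b\<close> to \<open>a\<close>; it is \<open>0\<close> for \<open>a = b\<close>.
  The Lorentz form is positive definite on tangent planes.\<close>

definition tangent_to :: "hyp2 \<Rightarrow> hyp2 \<Rightarrow> real^3" where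
  "tangent_to b a = coords a + lorentz (coords a) (coords b) *\<^sub>R coords b"

definition hangle :: "hyp2 \<Rightarrow> hyp2 \<Rightarrow> hyp2 \<Rightarrow> real" where
  "hangle a b c = arccos (lorentz (tangent_to b a) (tangent_to b c) /
     (sqrt (lorentz (tangent_to b a) (tangent_to b a)) *
      sqrt (lorentz (tangent_to b c) (tangent_to b c))))"

definition orth_proj :: "hyp2 set \<Rightarrow> hyp2 \<Rightarrow> hyp2" where
  "orth_proj l x =
     (THE t. t \<in> l \<and> (\<forall>s\<in>l. lorentz (tangent_to t x) (tangent_to t s) = 0))"

definition positively_oriented :: "hyp2 \<Rightarrow> hyp2 \<Rightarrow> hyp2 \<Rightarrow> bool" where
  "positively_oriented a b c \<longleftrightarrow> det (vector [coords a, coords b, coords c] :: real^3^3) > 0"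

definition hconvex :: "hyp2 set \<Rightarrow> bool" where
  "hconvex S \<longleftrightarrow> (\<forall>x\<in>S. \<forall>y\<in>S. geo_segment x y \<subseteq> S)"

definition convex_body :: "hyp2 set \<Rightarrow> bool" where
  "convex_body K \<longleftrightarrow> compact K \<and> hconvex K \<and> interior K \<noteq> {}"

definition polygon_with_vertices :: "hyp2 set \<Rightarrow> hyp2 set \<Rightarrow> bool" where
  "polygon_with_vertices P X \<longleftrightarrow> convex_body P \<and>
     (\<exists>V. finite V \<and> P = hconvex hull V \<and> X = {x \<in> V. x \<notin> hconvex hull (V - {x})})"

definition supporting_line :: "hyp2 set \<Rightarrow> hyp2 set \<Rightarrow> bool" where
  "supporting_line K l \<longleftrightarrow> (\<exists>n. lorentz n n > 0 \<and> l = normal_line n \<and> K \<inter> l \<noteq> {} \<and>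
     (K \<subseteq> normal_halfplane n \<or> K \<subseteq> normal_halfplane (- n)))"

text \<open>For a convex body the supremum and the infimum below are attained.\<close>

definition width :: "hyp2 set \<Rightarrow> hyp2 set \<Rightarrow> real" where
  "width K l = (SUP l'\<in>{l'. supporting_line K l'}. setdist l l')"

definition min_width :: "hyp2 set \<Rightarrow> real" where
  "min_width K = (INF l\<in>{l. supporting_line K l}. width K l)"

text \<open>Vertices are labelled by an \<open>n\<close>-periodic sequence \<open>v\<close> on \<open>nat\<close>, so that \<open>v 1, \<dots>, v n\<close>
  are the vertices and indices are read modulo \<open>n\<close>.\<close>

definition labelled_ngon :: "nat \<Rightarrow> (nat \<Rightarrow> hyp2) \<Rightarrow> hyp2 set \<Rightarrow> bool" where
  "labelled_ngon n v P \<longleftrightarrow>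
     (\<exists>X. polygon_with_vertices P X \<and> bij_betw v {1..n} X) \<and>
     (\<forall>i. v (i + n) = v i) \<and>
     (\<forall>i j k. 1 \<le> i \<and> i < j \<and> j < k \<and> k \<le> n \<longrightarrow> positively_oriented (v i) (v j) (v k))"

definition perim :: "nat \<Rightarrow> (nat \<Rightarrow> hyp2) \<Rightarrow> real" where
  "perim n v = (\<Sum>i=1..n. dist (v i) (v (i + 1)))"

definition foot :: "nat \<Rightarrow> (nat \<Rightarrow> hyp2) \<Rightarrow> nat \<Rightarrow> hyp2" where
  "foot n v i = orth_proj (line_through (v (i + (n - 1) div 2)) (v (i + (n + 1) div 2))) (v i)"

definition ordinary_reduced :: "nat \<Rightarrow> (nat \<Rightarrow> hyp2) \<Rightarrow> hyp2 set \<Rightarrow> real \<Rightarrow> bool" where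
  "ordinary_reduced n v P w \<longleftrightarrow>
     3 \<le> n \<and> odd n \<and> labelled_ngon n v P \<and> min_width P = w \<and>
     (\<forall>i. infdist (v i) (geo_segment (v (i + (n - 1) div 2)) (v (i + (n + 1) div 2))) = w \<and>
          foot n v i \<in> open_geo_segment (v (i + (n - 1) div 2)) (v (i + (n + 1) div 2)))"

definition crossing :: "nat \<Rightarrow> (nat \<Rightarrow> hyp2) \<Rightarrow> nat \<Rightarrow> hyp2" where
  "crossing n v i = (THE p. p \<in> geo_segment (v i) (foot n v i) \<and>
     p \<in> geo_segment (v (i + (n + 1) div 2)) (foot n v (i + (n + 1) div 2)))"

text \<open>The angle \<open>\<angle>(t\<^sub>i, p\<^sub>i, v\<^sub>j)\<close>, \<open>j = i + (n+1)/2\<close>, is the vertical angle of the one below.\<close>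

definition phi :: "nat \<Rightarrow> (nat \<Rightarrow> hyp2) \<Rightarrow> nat \<Rightarrow> real" where
  "phi n v i = hangle (v i) (crossing n v i) (foot n v (i + (n + 1) div 2))"

definition g_fun :: "real \<Rightarrow> real \<Rightarrow> real" where
  "g_fun w x = (1 + cos x - sqrt ((1 + cos x)\<^sup>2 - 4 * (tanh w)\<^sup>2 * cos x)) / (2 * tanh w)"

definition p_fun :: "real \<Rightarrow> real \<Rightarrow> real" where
  "p_fun w x = arcosh ((1 - g_fun w x * tanh w) / sqrt (1 - (tanh w)\<^sup>2))"

end

theory Submission
  imports Defs
begin

text \<open>Let \<open>j = i + (n + 1) div 2\<close>, and write \<open>a = v i\<close>, \<open>d = v j\<close>. The altitude from \<open>a\<close> ends at a
  foot \<open>t\<close> on a side with end point \<open>d\<close>, the altitude from \<open>d\<close> ends at a foot \<open>s\<close> on the side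
  from \<open>a\<close> to \<open>v (i + 1)\<close>, both have length \<open>w\<close>, and they cross at a point \<open>p\<close>. The theorem rests
  on the two right triangles \<open>a s p\<close> and \<open>d t p\<close> of this butterfly.

  Computing \<open>cosh (dist a d)\<close> by Pythagoras with the right angle at \<open>t\<close> and again at \<open>s\<close> gives
  \<open>dist d t = dist a s\<close>. Pythagoras in the two triangles at \<open>p\<close> then yields
  \<open>dist p s = dist p t = b\<close> with \<open>cosh (dist a s) = cosh (w - b) / cosh b\<close>, and the angle at \<open>p\<close>
  satisfies \<open>cos \<phi> = tanh b / tanh (w - b)\<close>. This is a quadratic equation for \<open>tanh b\<close>, whose
  smaller root is \<open>g_fun w \<phi>\<close>; substituting gives \<open>dist a s = p_fun w \<phi>\<close> (lemmas \<open>g_fun_eq_tanh\<close>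
  and \<open>butterfly\<close>).

  Each foot splits its side in two, so the perimeter is a sum of \<open>2 n\<close> such segments. Each
  butterfly accounts for two of them, \<open>dist a s\<close> and \<open>dist d t\<close>, both equal to \<open>p_fun w (phi n v i)\<close>
  (lemma \<open>dist_vertex_foot\<close>), and every piece belongs to exactly one butterfly.

  Points are handled through their coordinates on the hyperboloid. A point of a segment is a
  nonnegative combination of the end points, so incidence and crossing of segments are decided by
  signs of determinants; Pythagoras \<open>cosh (dist x s) = cosh (dist x t) * cosh (dist t s)\<close> is the
  orthogonality of two tangent vectors at \<open>t\<close>.\<close>

section \<open>The Lorentz form\<close>

lemma lorentz_add_left: "lorentz (x + y) z = lorentz x z + lorentz y z"
  and lorentz_add_right: "lorentz z (x + y) = lorentz z x + lorentz z y"
  and lorentz_diff_left: "lorentz (x - y) z = lorentz x z - lorentz y z"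
  and lorentz_diff_right: "lorentz z (x - y) = lorentz z x - lorentz z y"
  and lorentz_scaleR_left: "lorentz (c *\<^sub>R x) z = c * lorentz x z"
  and lorentz_scaleR_right: "lorentz z (c *\<^sub>R x) = c * lorentz z x"
  by (simp_all add: lorentz_def algebra_simps)

lemmas lorentz_linear = lorentz_add_left lorentz_add_right lorentz_diff_left lorentz_diff_right
  lorentz_scaleR_left lorentz_scaleR_right

lemma cosh_dist: "cosh (dist x y) = - lorentz (coords x) (coords y)"
  using lorentz_coords_le[of x y] by (simp add: dist_hyp2_def)

lemma lorentz_coords: "lorentz (coords x) (coords y) = - cosh (dist x y)"
  by (simp add: cosh_dist)

lemma cosh_dist_gt_1: "x \<noteq> y \<Longrightarrow> cosh (dist x y) > 1" for x y :: hyp2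
  using cosh_real_nonneg_less_iff[of 0 "dist x y"] by simp

text \<open>The orthogonal complement of a point of the hyperboloid is positive definite. This is how
  vector identities are proved below: it suffices to test the difference of the two sides against
  a point and against itself.\<close>

lemma lorentz_null_tangent_eq_0:
  assumes "lorentz u (coords x) = 0" and "lorentz u u = 0"
  shows "u = 0"
proof -
  define X where "X = coords x"
  have X: "(X$1)\<^sup>2 + (X$2)\<^sup>2 = (X$3)\<^sup>2 - 1"
    using lorentz_coords_self[of x] by (simp add: X_def lorentz_def power2_eq_square)
  have u: "(u$1)\<^sup>2 + (u$2)\<^sup>2 = (u$3)\<^sup>2" and ux: "u$1 * X$1 + u$2 * X$2 = u$3 * X$3"
    using assms by (simp_all add: X_def lorentz_def power2_eq_square)
  \<comment> \<open>Cauchy-Schwarz for the spatial parts, written as Lagrange's identity\<close>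
  have "(u$3 * X$3)\<^sup>2 + (u$1 * X$2 - u$2 * X$1)\<^sup>2
      = ((u$1)\<^sup>2 + (u$2)\<^sup>2) * ((X$1)\<^sup>2 + (X$2)\<^sup>2)"
    unfolding ux[symmetric] by (simp add: power2_eq_square algebra_simps)
  also have "\<dots> = (u$3 * X$3)\<^sup>2 - (u$3)\<^sup>2"
    unfolding u X by (simp add: power_mult_distrib algebra_simps)
  finally have "(u$3)\<^sup>2 + (u$1 * X$2 - u$2 * X$1)\<^sup>2 = 0" by simp
  then have "u$3 = 0"
    by (simp add: add_nonneg_eq_0_iff)
  with u have "u$1 = 0" "u$2 = 0"
    by (simp_all add: add_nonneg_eq_0_iff)
  with \<open>u$3 = 0\<close> show ?thesis by (simp add: vec_eq_iff forall_3)
qed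

lemma timelike_normalize:
  assumes "lorentz y y < 0" and "y$3 > 0"
  obtains t k where "k > 0" and "coords t = k *\<^sub>R y" and "k\<^sup>2 * lorentz y y = -1"
proof -
  define k where "k = 1 / sqrt (- lorentz y y)"
  have k: "k > 0" "k\<^sup>2 * lorentz y y = -1"
    using assms(1) by (simp_all add: k_def power_divide)
  have "k *\<^sub>R y \<in> {x. lorentz x x = -1 \<and> x$3 > 0}"
    using k assms(2) by (simp add: lorentz_linear power2_eq_square mult.assoc)
  then show ?thesis
    using that[of k "Abs_hyp2 (k *\<^sub>R y)"] k by (simp add: Abs_hyp2_inverse)
qed

lemma timelike_projective_point:
  assumes "lorentz y y < 0"
  obtains t k where "coords t = k *\<^sub>R y" and "k\<^sup>2 * lorentz y y = -1"
proof (cases "y$3 > 0")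
  case True
  then show ?thesis using timelike_normalize[OF assms] that by metis
next
  case False
  have "y$3 \<noteq> 0" using assms zero_le_square[of "y$1"] zero_le_square[of "y$2"]
    by (auto simp: lorentz_def simp del: zero_le_square)
  then have "lorentz (-y) (-y) < 0" "(-y)$3 > 0"
    using assms False by (simp_all add: lorentz_def)
  then obtain t k where "coords t = k *\<^sub>R (-y)" "k\<^sup>2 * lorentz (-y) (-y) = -1"
    using timelike_normalize by metis
  then show ?thesis using that[of t "-k"] by (simp add: lorentz_def)
qed

lemma hyp2_eq_if_proportional:
  assumes "coords p = k *\<^sub>R y" "coords q = l *\<^sub>R y" "k \<ge> 0" "l \<ge> 0"
  shows "p = q"
proof -
  have "k\<^sup>2 * lorentz y y = -1" "l\<^sup>2 * lorentz y y = -1"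
    using lorentz_coords_self[of p] lorentz_coords_self[of q] assms
    by (simp_all add: lorentz_linear power2_eq_square mult.assoc)
  then have "k\<^sup>2 = l\<^sup>2" by (metis mult_cancel_right mult_zero_right zero_neq_neg_one)
  then have "k = l" using assms by (simp add: power2_eq_iff_nonneg)
  then show ?thesis using assms by (metis coords_inject)
qed

section \<open>Geodesic segments\<close>

text \<open>The coefficients are \<open>sinh (dist z y) / sinh (dist x y)\<close> and
  \<open>sinh (dist x z) / sinh (dist x y)\<close>, as in the unit speed parametrization of the geodesic; for them
  the difference of the two sides is orthogonal to \<open>x\<close>, \<open>y\<close> and \<open>z\<close>, hence to itself.\<close>

lemma geo_segment_combination:
  assumes "z \<in> geo_segment x y" and "x \<noteq> y"
  obtains \<alpha> \<beta> where "coords z = \<alpha> *\<^sub>R coords x + \<beta> *\<^sub>R coords y" "\<alpha> \<ge> 0" "\<beta> \<ge> 0"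
    "z \<noteq> y \<Longrightarrow> \<alpha> > 0" "z \<noteq> x \<Longrightarrow> \<beta> > 0"
proof -
  define r s d where "r = dist x z" and "s = dist z y" and "d = dist x y"
  have d: "d = r + s" using assms(1) by (simp add: geo_segment_def r_def s_def d_def)
  have sd: "sinh d > 0" using assms(2) by (simp add: d_def)
  define \<alpha> \<beta> where "\<alpha> = sinh s / sinh d" and "\<beta> = sinh r / sinh d"
  have \<alpha>\<beta>: "\<alpha> * sinh d = sinh s" "\<beta> * sinh d = sinh r" using sd by (simp_all add: \<alpha>_def \<beta>_def)
  define u where "u = coords z - (\<alpha> *\<^sub>R coords x + \<beta> *\<^sub>R coords y)"
  have rsd: "dist x z = r" "dist z x = r" "dist z y = s" "dist y z = s" "dist x y = d" "dist y x = d"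
    by (simp_all add: r_def s_def d_def dist_commute)
  have "lorentz u (coords x) * sinh d = - cosh r * sinh d + \<alpha> * sinh d + \<beta> * sinh d * cosh d"
    by (simp add: u_def lorentz_linear lorentz_coords rsd algebra_simps)
  also have "\<dots> = sinh s - sinh (d - r)"
    unfolding \<alpha>\<beta> sinh_diff by (simp add: algebra_simps)
  finally have ux: "lorentz u (coords x) = 0" using sd by (simp add: d)
  have "lorentz u (coords y) * sinh d = - cosh s * sinh d + \<alpha> * sinh d * cosh d + \<beta> * sinh d"
    by (simp add: u_def lorentz_linear lorentz_coords rsd algebra_simps)
  also have "\<dots> = sinh r - sinh (d - s)"
    unfolding \<alpha>\<beta> sinh_diff by (simp add: algebra_simps)
  finally have uy: "lorentz u (coords y) = 0" using sd by (simp add: d)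
  have "lorentz u (coords z) * sinh d = - sinh d + \<alpha> * sinh d * cosh r + \<beta> * sinh d * cosh s"
    by (simp add: u_def lorentz_linear lorentz_coords rsd algebra_simps)
  also have "\<dots> = 0"
    unfolding \<alpha>\<beta> by (simp add: d sinh_add)
  finally have uz: "lorentz u (coords z) = 0" using sd by simp
  have "lorentz u u = lorentz u (coords z) - (\<alpha> * lorentz u (coords x) + \<beta> * lorentz u (coords y))"
    by (subst (2) u_def) (simp add: lorentz_linear)
  then have "lorentz u u = 0" by (simp add: ux uy uz)
  then have "u = 0" using lorentz_null_tangent_eq_0 ux by blast
  then show ?thesis
    using that[of \<alpha> \<beta>] sd by (simp add: u_def \<alpha>_def \<beta>_def r_def s_def)
qed

text \<open>Normalization of \<open>z\<close> expresses both \<open>sinh\<close> values through \<open>sinh (dist x y)\<close>, and then the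
  addition theorem for \<open>cosh\<close> shows that the two distances add up.\<close>

lemma combination_in_geo_segment:
  assumes "coords z = \<alpha> *\<^sub>R coords x + \<beta> *\<^sub>R coords y" "\<alpha> \<ge> 0" "\<beta> \<ge> 0"
  shows "z \<in> geo_segment x y"
proof -
  define r s d where "r = dist x z" and "s = dist z y" and "d = dist x y"
  define C where "C = cosh d"
  have rsd: "dist x z = r" "dist z x = r" "dist z y = s" "dist y z = s" "dist x y = d" "dist y x = d"
    by (simp_all add: r_def s_def d_def dist_commute)
  have nn: "r \<ge> 0" "s \<ge> 0" "d \<ge> 0" by (simp_all add: r_def s_def d_def)
  have cr: "cosh r = \<alpha> + \<beta> * C"
    by (simp add: C_def r_def d_def cosh_dist assms(1) lorentz_linear lorentz_coords_self lorentz_commute)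
  have cs: "cosh s = \<alpha> * C + \<beta>"
    by (simp add: C_def s_def d_def cosh_dist assms(1) lorentz_linear lorentz_coords_self lorentz_commute)
  have one: "\<alpha>\<^sup>2 + \<beta>\<^sup>2 + 2 * \<alpha> * \<beta> * C = 1"
    using lorentz_coords_self[of z] unfolding assms(1)
    by (simp add: C_def d_def cosh_dist lorentz_linear lorentz_coords_self lorentz_commute
        power2_eq_square algebra_simps)
  have sd: "(sinh d)\<^sup>2 = C\<^sup>2 - 1" by (simp add: C_def sinh_square_eq)
  have "(sinh r)\<^sup>2 = (\<beta> * sinh d)\<^sup>2"
    unfolding power_mult_distrib sd sinh_square_eq[of r] cr using one by (simp add: power2_eq_square) algebra
  then have sr: "sinh r = \<beta> * sinh d" using nn assms by (simp add: power2_eq_iff_nonneg)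
  have "(sinh s)\<^sup>2 = (\<alpha> * sinh d)\<^sup>2"
    unfolding power_mult_distrib sd sinh_square_eq[of s] cs using one by (simp add: power2_eq_square) algebra
  then have ss: "sinh s = \<alpha> * sinh d" using nn assms by (simp add: power2_eq_iff_nonneg)
  have "cosh (r + s) = (\<alpha> + \<beta> * C) * (\<alpha> * C + \<beta>) + \<alpha> * \<beta> * (sinh d)\<^sup>2"
    by (simp add: cosh_add cr cs sr ss power2_eq_square algebra_simps)
  also have "\<dots> = C" unfolding sd using one by algebra
  finally have "r + s = d" using nn by (simp add: C_def)
  then show ?thesis by (simp add: geo_segment_def rsd)
qed

section \<open>Lines and orthogonal projections\<close>

text \<open>The Lorentz analogue of the cross product: pairing it with a third vector gives the
  determinant, so it is a normal of the line through two points.\<close>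

definition lorentz_cross :: "real^3 \<Rightarrow> real^3 \<Rightarrow> real^3" where
  "lorentz_cross x y =
     vector [x$2 * y$3 - x$3 * y$2, x$3 * y$1 - x$1 * y$3, x$2 * y$1 - x$1 * y$2]"

lemma lorentz_cross_triple: "lorentz (lorentz_cross x y) z = det (vector [x, y, z] :: real^3^3)"
  by (simp add: lorentz_cross_def lorentz_def det_3 algebra_simps)

lemma lorentz_cross_self:
  "lorentz (lorentz_cross x y) (lorentz_cross x y) = (lorentz x y)\<^sup>2 - lorentz x x * lorentz y y"
  by (simp add: lorentz_cross_def lorentz_def power2_eq_square algebra_simps)

text \<open>Normals of the same line are proportional, so the line through two points is unique.\<close>

lemma normal_line_unique:
  assumes "a \<noteq> b" and "lorentz m m > 0" and "a \<in> normal_line m" "b \<in> normal_line m"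
  shows "normal_line m = normal_line (lorentz_cross (coords a) (coords b))"
proof -
  define N where "N = lorentz_cross (coords a) (coords b)"
  have dpos: "cosh (dist a b) > 1" using assms(1) by (rule cosh_dist_gt_1)
  have NN: "lorentz N N > 0"
    using dpos by (simp add: N_def lorentz_cross_self lorentz_coords one_less_power)
  have Nab: "lorentz N (coords a) = 0" "lorentz N (coords b) = 0"
    by (simp_all add: N_def lorentz_cross_triple det_3)
  have mab: "lorentz m (coords a) = 0" "lorentz m (coords b) = 0"
    using assms by (simp_all add: normal_line_def)
  define k where "k = lorentz m N / lorentz N N"
  define u where "u = m - k *\<^sub>R N"
  have ua: "lorentz u (coords a) = 0" and ub: "lorentz u (coords b) = 0"
    by (simp_all add: u_def lorentz_linear mab Nab)
  have "lorentz N u = 0"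
    using NN by (simp add: u_def k_def lorentz_linear lorentz_commute)
  then have "det (vector [coords a, coords b, u] :: real^3^3) = 0"
    by (simp add: N_def lorentz_cross_triple)
  \<comment> \<open>the Gram determinant of \<open>a\<close>, \<open>b\<close>, \<open>u\<close> vanishes, and \<open>u\<close> is orthogonal to \<open>a\<close>, \<open>b\<close>\<close>
  with lorentz_gram[of "coords a" "coords b" u] ua ub
  have "lorentz u u * (1 - (cosh (dist a b))\<^sup>2) = 0"
    by (simp add: lorentz_coords lorentz_commute algebra_simps)
  then have "lorentz u u = 0" using one_less_power[OF dpos, of 2] by auto
  then have "u = 0" using lorentz_null_tangent_eq_0 ua by blast
  then have mk: "m = k *\<^sub>R N" by (simp add: u_def)
  then have "k \<noteq> 0" using assms(2) by (auto simp: lorentz_def)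
  then show ?thesis by (simp add: normal_line_def mk lorentz_linear flip: N_def)
qed

lemma line_through_eq:
  assumes "a \<noteq> b"
  shows "is_line (line_through a b)" "a \<in> line_through a b" "b \<in> line_through a b"
proof -
  define N where "N = lorentz_cross (coords a) (coords b)"
  have "cosh (dist a b) > 1" using assms by (rule cosh_dist_gt_1)
  then have "lorentz N N > 0"
    by (simp add: N_def lorentz_cross_self lorentz_coords one_less_power)
  then have "is_line (normal_line N)" unfolding is_line_def by blast
  then have "is_line (normal_line N) \<and> a \<in> normal_line N \<and> b \<in> normal_line N"
    by (simp add: normal_line_def N_def lorentz_cross_triple det_3)
  moreover have "l = normal_line N" if "is_line l \<and> a \<in> l \<and> b \<in> l" for l
    using that normal_line_unique[OF assms] by (auto simp: is_line_def N_def)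
  ultimately have "is_line (line_through a b) \<and> a \<in> line_through a b \<and> b \<in> line_through a b"
    unfolding line_through_def by (rule theI)
  then show "is_line (line_through a b)" "a \<in> line_through a b" "b \<in> line_through a b"
    by auto
qed

lemma tangents_orthogonal_iff:
  "lorentz (tangent_to t x) (tangent_to t s) = 0 \<longleftrightarrow>
     cosh (dist x s) = cosh (dist x t) * cosh (dist t s)"
  by (auto simp: tangent_to_def lorentz_linear lorentz_coords dist_commute algebra_simps)

text \<open>Existence of the foot: subtract from \<open>x\<close> its component along the normal \<open>N\<close> and rescale
  the timelike rest \<open>y\<close> to the hyperboloid. Uniqueness: two feet \<open>t\<close> and \<open>t'\<close> can both be inserted
  into the relation of the other one, which forces \<open>cosh (dist t t') = 1\<close>.\<close>

lemma orth_proj_pythagoras: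
  assumes "is_line l"
  shows "orth_proj l x \<in> l"
    and "s \<in> l \<Longrightarrow> cosh (dist x s) = cosh (dist x (orth_proj l x)) * cosh (dist (orth_proj l x) s)"
proof -
  define Q where "Q t \<longleftrightarrow> t \<in> l \<and> (\<forall>s\<in>l. cosh (dist x s) = cosh (dist x t) * cosh (dist t s))" for t
  obtain N where N: "lorentz N N > 0" "l = normal_line N"
    using assms by (auto simp: is_line_def)
  define k where "k = lorentz (coords x) N / lorentz N N"
  define y where "y = coords x - k *\<^sub>R N"
  have yN: "lorentz y N = 0" using N by (simp add: y_def k_def lorentz_linear)
  have xy: "coords x = y + k *\<^sub>R N" by (simp add: y_def)
  have "lorentz y y = -1 - k\<^sup>2 * lorentz N N"
    using lorentz_coords_self[of x] yN
    by (simp add: xy lorentz_linear lorentz_commute[of N y] power2_eq_square)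
  also have "\<dots> < 0" using N by (smt (verit) mult_nonneg_nonneg zero_le_power2)
  finally obtain t r where t: "coords t = r *\<^sub>R y" "r\<^sup>2 * lorentz y y = -1"
    using timelike_projective_point by metis
  have "Q t" unfolding Q_def
  proof (intro conjI ballI)
    show "t \<in> l" using yN by (simp add: N normal_line_def t lorentz_linear lorentz_commute)
    fix s assume "s \<in> l"
    then have Ns: "lorentz N (coords s) = 0" by (simp add: N normal_line_def)
    have xt: "lorentz (coords x) (coords t) = r * lorentz y y"
      using yN by (simp add: t xy lorentz_linear lorentz_commute[of N y])
    have "lorentz (coords x) (coords t) * lorentz (coords t) (coords s)
        = (r\<^sup>2 * lorentz y y) * lorentz y (coords s)"
      unfolding xt by (simp add: t lorentz_linear power2_eq_square)
    also have "\<dots> = - lorentz (coords x) (coords s)"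
      unfolding t by (simp add: xy lorentz_linear Ns)
    finally show "cosh (dist x s) = cosh (dist x t) * cosh (dist t s)"
      by (simp add: cosh_dist)
  qed
  moreover have "t' = t" if "Q t'" for t'
  proof -
    have "cosh (dist x t) = cosh (dist x t) * (cosh (dist t t'))\<^sup>2"
      using that \<open>Q t\<close> unfolding Q_def
      by (metis dist_commute mult.assoc power2_eq_square)
    then have "(cosh (dist t t'))\<^sup>2 = 1\<^sup>2" by simp
    then have "cosh (dist t t') = 1" by (simp only: power2_eq_iff_nonneg cosh_real_nonneg zero_le_one)
    then show ?thesis using cosh_dist_gt_1[of t t'] by force
  qed
  ultimately have "Q (THE t. Q t)" by (rule theI)
  moreover have "(THE t. Q t) = orth_proj l x"
    by (simp add: orth_proj_def Q_def tangents_orthogonal_iff)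
  ultimately have "Q (orth_proj l x)" by simp
  then show "orth_proj l x \<in> l"
    and "s \<in> l \<Longrightarrow> cosh (dist x s) = cosh (dist x (orth_proj l x)) * cosh (dist (orth_proj l x) s)"
    unfolding Q_def by blast+
qed

text \<open>By Pythagoras the foot is the point of the line that is nearest to \<open>x\<close>.\<close>

lemma infdist_segment_eq_dist_foot:
  assumes "a \<noteq> b" and "orth_proj (line_through a b) x \<in> geo_segment a b"
  shows "infdist x (geo_segment a b) = dist x (orth_proj (line_through a b) x)"
proof -
  define t where "t = orth_proj (line_through a b) x"
  have "dist x t \<le> dist x s" if s: "s \<in> geo_segment a b" for s
  proof -
    obtain \<alpha> \<beta> where c: "coords s = \<alpha> *\<^sub>R coords a + \<beta> *\<^sub>R coords b"
      using geo_segment_combination[OF s assms(1)] by metis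
    obtain N where "line_through a b = normal_line N"
      using line_through_eq(1)[OF assms(1)] by (auto simp: is_line_def)
    then have "s \<in> line_through a b"
      using line_through_eq(2,3)[OF assms(1)] by (simp add: normal_line_def c lorentz_linear)
    then have "cosh (dist x s) = cosh (dist x t) * cosh (dist t s)"
      unfolding t_def using orth_proj_pythagoras(2) line_through_eq(1)[OF assms(1)] by blast
    then have "cosh (dist x t) \<le> cosh (dist x s)"
      using mult_left_mono[of 1 "cosh (dist t s)" "cosh (dist x t)"] cosh_real_ge_1 by simp
    then show ?thesis by (subst (asm) cosh_real_nonneg_le_iff) simp_all
  qed
  then have "infdist x (geo_segment a b) \<ge> dist x t"
    using assms(2) by (auto simp: infdist_def t_def intro!: cINF_greatest)
  moreover have "infdist x (geo_segment a b) \<le> dist x t"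
    using assms(2) by (simp add: infdist_le t_def)
  ultimately show ?thesis by (simp add: t_def)
qed

section \<open>Crossing segments\<close>

abbreviation orient :: "hyp2 \<Rightarrow> hyp2 \<Rightarrow> hyp2 \<Rightarrow> real" where
  "orient a b c \<equiv> det (vector [coords a, coords b, coords c] :: real^3^3)"

lemma orient_rotate: "orient a b c = orient b c a"
  by (simp add: det_3)

lemma orient_repeat [simp]: "orient a b b = 0" "orient a a b = 0" "orient a b a = 0"
  by (simp_all add: det_3)

lemma orient_combination:
  assumes "coords s = \<alpha> *\<^sub>R coords c + \<beta> *\<^sub>R coords d"
  shows "orient a b s = \<alpha> * orient a b c + \<beta> * orient a b d"
  by (simp add: det_3 assms algebra_simps)

text \<open>The assumptions say that \<open>a\<close>, \<open>s\<close>, \<open>t\<close>, \<open>d\<close> are the corners of a convex quadrilateral, with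
  diagonals from \<open>a\<close> to \<open>t\<close> and from \<open>d\<close> to \<open>s\<close>. By Cramer's rule the four vectors satisfy one
  linear relation, and its coefficients are these determinants up to sign. With the terms sorted by
  sign it equates a positive combination of \<open>a\<close>, \<open>t\<close> with one of \<open>d\<close>, \<open>s\<close>: the crossing point up
  to scale.\<close>

lemma segments_cross:
  assumes pos: "orient a s t > 0" "orient s t d > 0" "orient t d a > 0" "orient d a s > 0"
  shows "\<exists>!p. p \<in> geo_segment a t \<and> p \<in> geo_segment d s"
proof -
  define e1 e2 e3 e4 where
    "e1 = orient s t d" and "e2 = orient d a s" and "e3 = orient t d a" and "e4 = orient a s t"
  define y where "y = e1 *\<^sub>R coords a + e2 *\<^sub>R coords t"
  have ne: "a \<noteq> t" "d \<noteq> s" using pos by auto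
  have epos: "e1 > 0" "e2 > 0" "e3 > 0" "e4 > 0" using pos by (simp_all add: e1_def e2_def e3_def e4_def)
  \<comment> \<open>Cramer's relation\<close>
  have y': "y = e4 *\<^sub>R coords d + e3 *\<^sub>R coords s"
    unfolding vec_eq_iff forall_3 y_def e1_def e2_def e3_def e4_def det_3 vector_3
    by (simp add: algebra_simps)
  have "lorentz y y = - e1\<^sup>2 - e2\<^sup>2 - 2 * (e1 * e2 * cosh (dist a t))"
    by (simp add: y_def lorentz_linear lorentz_coords dist_commute power2_eq_square algebra_simps)
  also have "\<dots> < 0"
    using epos mult_pos_pos[OF mult_pos_pos[OF epos(1,2)] cosh_real_pos[of "dist a t"]]
    by (smt (verit) zero_less_power)
  finally have yy: "lorentz y y < 0" .
  have "y$3 > 0" using epos coords_3_pos[of a] coords_3_pos[of t] by (simp add: y_def add_pos_pos)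
  then obtain p k where p: "k > 0" "coords p = k *\<^sub>R y"
    using timelike_normalize[OF yy] by metis
  show ?thesis
  proof (rule ex1I)
    show "p \<in> geo_segment a t \<and> p \<in> geo_segment d s"
    proof
      show "p \<in> geo_segment a t"
        using combination_in_geo_segment[of p "k * e1" a "k * e2" t] p epos
        by (simp add: y_def scaleR_add_right)
      show "p \<in> geo_segment d s"
        using combination_in_geo_segment[of p "k * e4" d "k * e3" s] p epos
        by (simp add: y' scaleR_add_right)
    qed
    fix q assume q: "q \<in> geo_segment a t \<and> q \<in> geo_segment d s"
    obtain \<alpha> \<beta> where c: "coords q = \<alpha> *\<^sub>R coords a + \<beta> *\<^sub>R coords t" "\<alpha> \<ge> 0" "\<beta> \<ge> 0"
      using geo_segment_combination[of q a t] q ne by metis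
    obtain \<gamma> \<delta> where "coords q = \<gamma> *\<^sub>R coords d + \<delta> *\<^sub>R coords s"
      using geo_segment_combination[of q d s] q ne by metis
    then have "orient s d q = 0" using orient_combination by fastforce
    then have "\<alpha> * orient s d a + \<beta> * orient s d t = 0" using orient_combination[OF c(1)] by metis
    moreover have "orient s d a = e2" "orient s d t = - e1"
      by (simp_all add: e1_def e2_def det_3 algebra_simps)
    ultimately have "\<beta> = \<alpha> / e1 * e2" using epos by (simp add: field_simps)
    then have "coords q = (\<alpha> / e1) *\<^sub>R y"
      using epos by (simp add: c y_def scaleR_add_right)
    then show "q = p"
      using hyp2_eq_if_proportional[of q "\<alpha> / e1" y p k] p c epos by simp
  qed
qed

section \<open>The butterfly formed by two altitudes\<close>

lemma cosh_inj_nonneg: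
  fixes x y :: real
  assumes "cosh x = cosh y" "0 \<le> x" "0 \<le> y"
  shows "x = y"
  using assms cosh_real_nonneg_le_iff[of x y] cosh_real_nonneg_le_iff[of y x] by simp

text \<open>The tangent vector from \<open>b\<close> to \<open>a\<close> has Lorentz norm \<open>sinh (dist a b)\<close>. In the degenerate cases
  \<open>a = b\<close> and \<open>b = c\<close> both sides are \<open>arccos 0\<close>, because division by zero gives zero.\<close>

lemma hangle_law_of_cosines:
  "hangle a b c = arccos ((cosh (dist a b) * cosh (dist b c) - cosh (dist a c)) /
     (sinh (dist a b) * sinh (dist b c)))"
proof -
  have "sqrt (lorentz (tangent_to b x) (tangent_to b x)) = sinh (dist b x)" for x
  proof -
    have "lorentz (tangent_to b x) (tangent_to b x) = (sinh (dist b x))\<^sup>2"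
      unfolding sinh_square_eq
      by (simp add: tangent_to_def lorentz_linear lorentz_coords dist_commute
          power2_eq_square algebra_simps)
    then show ?thesis by simp
  qed
  moreover have "lorentz (tangent_to b a) (tangent_to b c)
      = cosh (dist a b) * cosh (dist b c) - cosh (dist a c)"
    by (simp add: tangent_to_def lorentz_linear lorentz_coords dist_commute algebra_simps)
  ultimately show ?thesis by (simp add: hangle_def dist_commute)
qed

text \<open>With \<open>y = tanh a\<close> and \<open>z = tanh (w - a)\<close>, the addition theorem turns \<open>y = cos x * z\<close> into the
  quadratic equation \<open>tanh w * y\<^sup>2 - (1 + cos x) * y + tanh w * cos x = 0\<close>. Its other root
  is \<open>1 / z > 1 > y\<close>, so \<open>y\<close> is the smaller root, which is \<open>g_fun w x\<close>.\<close>

lemma g_fun_eq_tanh: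
  assumes "0 < a" "a < w" and "cos x = tanh a / tanh (w - a)"
  shows "g_fun w x = tanh a"
proof -
  define y z where "y = tanh a" and "z = tanh (w - a)"
  have yz: "0 < y" "0 < z" "y < 1" "z < 1"
    using assms by (simp_all add: y_def z_def tanh_real_lt_1)
  have yz1: "y * z < 1" using mult_strict_mono[of y 1 z 1] yz by simp
  have "tanh w = tanh (a + (w - a))" by simp
  also have "\<dots> = (y + z) / (1 + y * z)" by (subst tanh_add) (simp_all add: y_def z_def)
  finally have T: "tanh w = (y + z) / (1 + y * z)" .
  have c: "cos x = y / z" using assms by (simp add: y_def z_def)
  \<comment> \<open>the root of the discriminant: \<open>tanh w\<close> times the difference \<open>1 / z - y\<close> of the two roots\<close>
  define R where "R = (y + z) * (1 - y * z) / (z * (1 + y * z))"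
  have nz: "1 + y * z > 0" "y + z > 0" using yz by (simp_all add: add_pos_pos)
  then have nz': "1 + y * z \<noteq> 0" "y + z \<noteq> 0" "z \<noteq> 0" using yz by auto
  have "(1 + cos x)\<^sup>2 - 4 * (tanh w)\<^sup>2 * cos x = R\<^sup>2"
    unfolding c T R_def using nz' by (simp add: divide_simps) algebra
  moreover have "R \<ge> 0" using yz yz1 nz by (simp add: R_def)
  ultimately have "g_fun w x = (1 + y / z - R) / (2 * ((y + z) / (1 + y * z)))"
    by (simp add: g_fun_def c T)
  also have "\<dots> = y" unfolding R_def using nz' by (simp add: divide_simps) algebra
  finally show ?thesis by (simp add: y_def)
qed

text \<open>Two altitudes of equal length \<open>w\<close>, from \<open>a\<close> with foot \<open>t\<close> and from \<open>d\<close> with foot \<open>s\<close>, cross at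
  \<open>p\<close>. The two Pythagorean relations share their left-hand side, so the outer legs \<open>dist s a\<close> and
  \<open>dist t d\<close> agree, and then the butterfly turns out to be symmetric, with
  \<open>dist p s = dist p t\<close>.\<close>

lemma butterfly:
  assumes w: "w > 0"
    and segs: "p \<in> geo_segment a t" "p \<in> geo_segment d s"
    and alt: "dist a t = w" "dist d s = w"
    and right_t: "cosh (dist a d) = cosh (dist a t) * cosh (dist t d)"
    and right_s: "cosh (dist d a) = cosh (dist d s) * cosh (dist s a)"
    and ne: "s \<noteq> a" "p \<noteq> s"
  shows "dist a s = p_fun w (hangle a p s)" "dist d t = p_fun w (hangle a p s)"
proof -
  define q where "q = cosh (dist s a)"
  have q1: "q > 1" using ne by (simp add: q_def cosh_dist_gt_1)
  have "cosh (dist t d) = q" using right_t right_s by (simp add: q_def alt dist_commute)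
  then have ds: "dist t d = dist s a" by (intro cosh_inj_nonneg[of "dist t d" "dist s a"]) (simp_all add: q_def)
  define b c where "b = dist p s" and "c = dist p t"
  have pa: "dist p a = w - c" and pd: "dist p d = w - b"
    using segs alt by (simp_all add: geo_segment_def b_def c_def dist_commute)
  have bc: "0 < b" "b \<le> w" "0 \<le> c" "c \<le> w"
    using ne pa pd zero_le_dist[of p a] zero_le_dist[of p d] by (simp_all add: b_def c_def)
  have at: "a \<noteq> t" "d \<noteq> s" using w alt by auto
  obtain \<alpha> \<beta> where p1: "coords p = \<alpha> *\<^sub>R coords a + \<beta> *\<^sub>R coords t"
    using geo_segment_combination[OF segs(1) at(1)] by metis
  obtain \<gamma> \<delta> where p2: "coords p = \<gamma> *\<^sub>R coords d + \<delta> *\<^sub>R coords s"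
    using geo_segment_combination[OF segs(2) at(2)] by metis
  \<comment> \<open>Pythagoras is linear in the vertex off the line, so it passes from \<open>a\<close> to \<open>p\<close>,
    and likewise from \<open>d\<close> to \<open>p\<close>\<close>
  have "cosh (dist p d) = cosh (dist p t) * cosh (dist t d)"
    using right_t unfolding cosh_dist p1 lorentz_linear lorentz_coords_self by algebra
  then have e1: "cosh (w - b) = q * cosh c"
    using ds by (simp add: pd c_def q_def)
  have "cosh (dist p a) = cosh (dist p s) * cosh (dist s a)"
    using right_s unfolding cosh_dist p2 lorentz_linear lorentz_coords_self by algebra
  then have e2: "cosh (w - c) = q * cosh b"
    by (simp add: pa b_def q_def)
  have "cosh (w - b) * cosh b = cosh (w - c) * cosh c" unfolding e1 e2 by simp
  then have "cosh (w - 2 * b) = cosh (w - 2 * c)"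
  proof -
    have "cosh (w - 2 * u) = 2 * (cosh (w - u) * cosh u) - cosh w" for u
      using cosh_add[of "w - u" u] cosh_diff[of "w - u" u] by simp
    then show ?thesis using \<open>cosh (w - b) * cosh b = cosh (w - c) * cosh c\<close> by simp
  qed
  then have "\<bar>w - 2 * b\<bar> = \<bar>w - 2 * c\<bar>"
    using cosh_inj_nonneg[of "\<bar>w - 2 * b\<bar>" "\<bar>w - 2 * c\<bar>"] by simp
  then have "b = c \<or> c = w - b" by linarith
  \<comment> \<open>the asymmetric solution would make the leg \<open>dist s a\<close> vanish\<close>
  moreover have "c \<noteq> w - b" using e1 q1 by auto
  ultimately have cb: "c = b" by auto
  have qe: "q = cosh (w - b) / cosh b" using e1 cb by simp
  have "cosh b < cosh (w - b)"
    using mult_strict_right_mono[OF q1, of "cosh b"] e1 cb by simp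
  then have bw: "b < w - b" using bc by (simp add: cosh_real_nonneg_less_iff)
  define x where "x = hangle a p s"
  have sp: "sinh b > 0" "sinh (w - b) > 0" "cosh b > 0" using bc bw by simp_all
  have "x = arccos ((cosh (w - b) * cosh b - q) / (sinh (w - b) * sinh b))"
    unfolding x_def hangle_law_of_cosines
    using pa cb by (simp add: q_def b_def dist_commute)
  also have "cosh (w - b) * cosh b - q = cosh (w - b) * ((cosh b)\<^sup>2 - 1) / cosh b"
    using sp unfolding qe by (simp add: field_simps power2_eq_square)
  also have "\<dots> = cosh (w - b) * (sinh b)\<^sup>2 / cosh b" by (simp add: sinh_square_eq)
  also have "\<dots> / (sinh (w - b) * sinh b) = tanh b / tanh (w - b)"
    using sp by (simp add: tanh_def field_simps power2_eq_square)
  finally have "x = arccos (tanh b / tanh (w - b))" .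
  moreover have "0 \<le> tanh b / tanh (w - b)" "tanh b / tanh (w - b) \<le> 1"
    using bc bw by simp_all
  ultimately have "cos x = tanh b / tanh (w - b)" by (simp add: cos_arccos)
  then have g: "g_fun w x = tanh b" using g_fun_eq_tanh[of b w x] bc bw by simp
  have "1 - (tanh w)\<^sup>2 = 1 / (cosh w)\<^sup>2"
    by (simp add: tanh_def power_divide sinh_square_eq diff_divide_distrib)
  then have "sqrt (1 - (tanh w)\<^sup>2) = 1 / cosh w" by (simp add: real_sqrt_divide)
  then have "(1 - g_fun w x * tanh w) / sqrt (1 - (tanh w)\<^sup>2) = (1 - tanh b * tanh w) * cosh w"
    by (simp add: g)
  also have "\<dots> = q" using sp unfolding qe cosh_diff by (simp add: tanh_def field_simps)
  finally have "p_fun w x = arcosh (cosh (dist s a))" by (simp add: p_fun_def q_def)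
  then have "p_fun w x = dist s a" by (simp add: arcosh_cosh_real)
  then show "dist a s = p_fun w (hangle a p s)" "dist d t = p_fun w (hangle a p s)"
    using ds by (simp_all add: x_def dist_commute)
qed

section \<open>Ordinary reduced polygons\<close>

lemma periodic_shift:
  fixes f :: "nat \<Rightarrow> 'a"
  assumes "\<And>i. f (i + n) = f i"
  shows "f (i + k * n) = f i"
proof (induction k)
  case (Suc k)
  then show ?case using assms[of "i + k * n"] by (simp add: algebra_simps)
qed simp

lemma sum_periodic_shift:
  fixes f :: "nat \<Rightarrow> real"
  assumes "\<And>i. f (i + n) = f i"
  shows "(\<Sum>i=1..n. f (i + k)) = (\<Sum>i=1..n. f i)"
proof (induction k)
  case (Suc k)
  have "(\<Sum>i=1..n. f (i + Suc k)) = (\<Sum>i=Suc 1..Suc n. f (i + k))"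
    by (subst sum.shift_bounds_cl_Suc_ivl) simp
  also have "\<dots> + f (1 + k) = (\<Sum>i=1..Suc n. f (i + k))"
    by (subst (2) sum.atLeast_Suc_atMost) simp_all
  also have "\<dots> = (\<Sum>i=1..n. f (i + k)) + f (1 + k)"
    using assms[of "1 + k"] by (simp add: ac_simps)
  finally show ?case using Suc by simp
qed simp

text \<open>Reading indices modulo \<open>n\<close> rotates an increasing triple cyclically, and the determinant is
  invariant under cyclic rotation.\<close>

lemma labelled_ngon_orient:
  assumes "labelled_ngon n v P" "1 \<le> a" "a < b" "b < c" "c < a + n"
  shows "orient (v a) (v b) (v c) > 0"
proof -
  have per: "v (i + n) = v i" for i using assms(1) by (simp add: labelled_ngon_def)
  have ord: "orient (v i) (v j) (v k) > 0" if "1 \<le> i" "i < j" "j < k" "k \<le> n" for i j k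
    using assms(1) that by (auto simp: labelled_ngon_def positively_oriented_def)
  have n: "n > 0" using assms by simp
  have base: "orient (v a) (v b) (v c) > 0"
    if "1 \<le> a" "a \<le> n" "a < b" "b < c" "c < a + n" for a b c
  proof -
    consider "c \<le> n" | "b \<le> n" "n < c" | "n < b" by linarith
    then show ?thesis
    proof cases
      case 1
      then show ?thesis using ord that by simp
    next
      case 2
      then have "orient (v (c - n)) (v a) (v b) > 0" using that by (intro ord) auto
      then show ?thesis using per[of "c - n"] 2 by (simp add: orient_rotate[of "v (c - n)"])
    next
      case 3
      then have "orient (v (b - n)) (v (c - n)) (v a) > 0" using that by (intro ord) auto
      then show ?thesis using per[of "c - n"] per[of "b - n"] 3 that
        by (simp add: orient_rotate[of "v a"])
    qed
  qed
  define k where "k = (a - 1) div n"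
  have "a - 1 = k * n + (a - 1) mod n" by (simp add: k_def)
  moreover have "(a - 1) mod n < n" using n by simp
  ultimately have k: "k * n < a" "a \<le> n + k * n" using assms(2) by linarith+
  have "orient (v (a - k * n)) (v (b - k * n)) (v (c - k * n)) > 0"
    using k assms by (intro base) auto
  moreover have "v (i - k * n) = v i" if "k * n < i" for i
    using periodic_shift[of v n "i - k * n" k] per that by simp
  ultimately show ?thesis using k assms by simp
qed

lemma foot_properties:
  assumes "v (i + (n - 1) div 2) \<noteq> v (i + (n + 1) div 2)"
    and "ordinary_reduced n v P w"
  defines "t \<equiv> foot n v i"
  shows "t \<in> open_geo_segment (v (i + (n - 1) div 2)) (v (i + (n + 1) div 2))"
    and "dist (v i) t = w"
    and "cosh (dist (v i) (v (i + (n - 1) div 2)))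
      = cosh (dist (v i) t) * cosh (dist t (v (i + (n - 1) div 2)))"
    and "cosh (dist (v i) (v (i + (n + 1) div 2)))
      = cosh (dist (v i) t) * cosh (dist t (v (i + (n + 1) div 2)))"
proof -
  show op: "t \<in> open_geo_segment (v (i + (n - 1) div 2)) (v (i + (n + 1) div 2))"
    using assms(2) unfolding t_def ordinary_reduced_def by blast
  have "infdist (v i) (geo_segment (v (i + (n - 1) div 2)) (v (i + (n + 1) div 2))) = w"
    using assms(2) unfolding ordinary_reduced_def by blast
  then show "dist (v i) t = w"
    using infdist_segment_eq_dist_foot[OF assms(1), of "v i"] op
    by (simp add: t_def foot_def open_geo_segment_def)
  show "cosh (dist (v i) (v (i + (n - 1) div 2)))
      = cosh (dist (v i) t) * cosh (dist t (v (i + (n - 1) div 2)))"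
    "cosh (dist (v i) (v (i + (n + 1) div 2)))
      = cosh (dist (v i) t) * cosh (dist t (v (i + (n + 1) div 2)))"
    using orth_proj_pythagoras(2) line_through_eq[OF assms(1)]
    unfolding t_def foot_def by blast+
qed

text \<open>The butterfly at \<open>i\<close> has its corners on the sides from \<open>a = v i\<close> to \<open>b = v (i + 1)\<close> and from
  \<open>c = v (i + m)\<close> to \<open>d = v (i + m + 1)\<close>, where \<open>n = 2 * m + 1\<close>. The feet are positive combinations
  of the end points of these sides, so the orientations of the vertices give those that the crossing
  of the altitudes needs.\<close>

lemma dist_vertex_foot:
  assumes "w > 0" and "n \<ge> 3" and "odd n" and red: "ordinary_reduced n v P w" and "i \<ge> 1"
  defines "j \<equiv> i + (n + 1) div 2"
  shows "dist (v i) (foot n v j) = p_fun w (phi n v i)"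
    and "dist (v j) (foot n v i) = p_fun w (phi n v i)"
    and "dist (v i) (v (i + 1)) = dist (v i) (foot n v j) + dist (v (i + 1)) (foot n v j)"
proof -
  obtain m where n: "n = 2 * m + 1" using \<open>odd n\<close> by (auto elim: oddE)
  then have m: "m \<ge> 1" using assms by simp
  have jm: "j = i + m + 1" "(n - 1) div 2 = m" "(n + 1) div 2 = m + 1"
    by (simp_all add: j_def n)
  have ngon: "labelled_ngon n v P" using red by (simp add: ordinary_reduced_def)
  have per: "v (k + n) = v k" for k using ngon by (simp add: labelled_ngon_def)
  have jw: "v (j + m) = v i" "v (j + (m + 1)) = v (i + 1)"
  proof -
    have "j + m = i + n" "j + (m + 1) = i + 1 + n" by (simp_all add: jm n)
    then show "v (j + m) = v i" "v (j + (m + 1)) = v (i + 1)" by (simp_all only: per)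
  qed
  have ij: "i + (m + 1) = j" by (simp add: jm)
  define a b c d where abcd: "a = v i" "b = v (i + 1)" "c = v (i + m)" "d = v j"
  define s t where st: "s = foot n v j" "t = foot n v i"
  have abd: "orient a b d > 0" and acd: "orient a c d > 0"
    unfolding abcd jm using m by (auto intro!: labelled_ngon_orient[OF ngon] assms(5) simp: n)
  have "orient a b c \<ge> 0 \<and> orient b c d \<ge> 0"
  \<comment> \<open>in a triangle the two sides meet: \<open>b = c\<close>, and both determinants vanish\<close>
  proof (cases "m = 1")
    case False
    with m have "m \<ge> 2" by simp
    then have "orient (v i) (v (i + 1)) (v (i + m)) > 0"
      "orient (v (i + 1)) (v (i + m)) (v (i + m + 1)) > 0"
      by (intro labelled_ngon_orient[OF ngon]; use assms(5) n in linarith)+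
    then show ?thesis unfolding abcd jm by (intro conjI less_imp_le)
  qed (simp add: abcd)
  then have abc: "orient a b c \<ge> 0" and bcd: "orient b c d \<ge> 0" by auto
  have ne: "a \<noteq> b" "c \<noteq> d" using abd acd by auto
  have T: "t \<in> open_geo_segment c d" "dist a t = w" "cosh (dist a d) = cosh (dist a t) * cosh (dist t d)"
    using foot_properties[of v i n, OF _ red, unfolded jm(2,3) ij] ne(2)
    unfolding abcd st by blast+
  have S: "s \<in> open_geo_segment a b" "dist d s = w" "cosh (dist d a) = cosh (dist d s) * cosh (dist s a)"
    using foot_properties[of v j n, OF _ red, unfolded jm(2,3) jw] ne(1)
    unfolding abcd st by blast+
  obtain \<alpha> \<beta> where s: "coords s = \<alpha> *\<^sub>R coords a + \<beta> *\<^sub>R coords b" "\<alpha> > 0" "\<beta> > 0"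
    using geo_segment_combination[of s a b] S(1) ne by (auto simp: open_geo_segment_def)
  obtain \<gamma> \<delta> where t: "coords t = \<gamma> *\<^sub>R coords c + \<delta> *\<^sub>R coords d" "\<gamma> > 0" "\<delta> > 0"
    using geo_segment_combination[of t c d] T(1) ne by (auto simp: open_geo_segment_def)
  have "orient d a s = \<beta> * orient a b d"
    using orient_combination[OF s(1), of d a] orient_rotate[of d a b] by simp
  then have das: "orient d a s > 0" using abd s by simp
  have "orient d a t = \<gamma> * orient a c d"
    using orient_combination[OF t(1), of d a] orient_rotate[of d a c] by simp
  then have tda: "orient t d a > 0" using acd t orient_rotate[of t d a] by simp
  have "orient t a s = \<beta> * orient a b t"
    using orient_combination[OF s(1), of t a] orient_rotate[of t a b] by simp
  also have "\<dots> = \<beta> * (\<gamma> * orient a b c + \<delta> * orient a b d)"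
    using orient_combination[OF t(1), of a b] by simp
  finally have "orient t a s > 0" using abc abd s t by (simp add: add_nonneg_pos)
  then have ast: "orient a s t > 0" using orient_rotate[of t a s] by simp
  have "orient d s t = \<gamma> * orient d s c"
    using orient_combination[OF t(1), of d s] by simp
  also have "orient d s c = orient c d s" using orient_rotate[of c d s] by simp
  also have "\<dots> = \<alpha> * orient a c d + \<beta> * orient b c d"
    using orient_combination[OF s(1), of c d] orient_rotate[of a c d] orient_rotate[of b c d] by simp
  finally have "orient d s t > 0" using acd bcd s t by (simp add: add_pos_nonneg)
  then have std: "orient s t d > 0" using orient_rotate[of d s t] by simp
  define p where "p = crossing n v i"
  have p: "p \<in> geo_segment a t" "p \<in> geo_segment d s"
    using theI'[OF segments_cross[OF ast std tda das]]
    by (auto simp: p_def crossing_def abcd st j_def)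
  \<comment> \<open>otherwise \<open>a\<close>, \<open>s\<close>, \<open>t\<close> would be collinear\<close>
  have "p \<noteq> s"
  proof
    assume "p = s"
    then obtain \<epsilon> \<zeta> where "coords s = \<epsilon> *\<^sub>R coords a + \<zeta> *\<^sub>R coords t"
      using geo_segment_combination[of p a t] p ast by (metis orient_repeat(3) less_irrefl)
    then have "orient t a s = 0" using orient_combination by fastforce
    then show False using \<open>orient t a s > 0\<close> by simp
  qed
  moreover have "s \<noteq> a" using S(1) by (simp add: open_geo_segment_def)
  ultimately have "dist a s = p_fun w (hangle a p s)" "dist d t = p_fun w (hangle a p s)"
    using butterfly[OF assms(1) p T(2) S(2) T(3) S(3)] by auto
  moreover have "hangle a p s = phi n v i" by (simp add: phi_def p_def abcd st j_def)
  ultimately show "dist (v i) (foot n v j) = p_fun w (phi n v i)"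
    "dist (v j) (foot n v i) = p_fun w (phi n v i)" by (simp_all add: abcd st)
  show "dist (v i) (v (i + 1)) = dist (v i) (foot n v j) + dist (v (i + 1)) (foot n v j)"
    using S(1) unfolding open_geo_segment_def geo_segment_def abcd st by (auto simp: dist_commute)
qed

theorem theorem4p1:
  fixes w :: real and n :: nat and v :: "nat \<Rightarrow> hyp2" and P :: "hyp2 set"
  assumes "w > 0" and "n \<ge> 3" and "odd n"
    and "ordinary_reduced n v P w"
  shows "perim n v = 2 * (\<Sum>i=1..n. p_fun w (phi n v i))"
proof -
  define h where "h = (n + 1) div 2"
  define f where "f i = p_fun w (phi n v i)" for i
  have per: "v (i + n) = v i" for i
    using assms(4) by (simp add: ordinary_reduced_def labelled_ngon_def)
  have per': "v (i + n + k) = v (i + k)" for i k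
    using per[of "i + k"] by (simp add: ac_simps)
  have foot_per: "foot n v (i + n + k) = foot n v (i + k)" for i k
    unfolding foot_def using per'[of i] by (simp add: add.assoc)
  have f_per: "f (i + n) = f i" for i
    unfolding f_def phi_def crossing_def foot_per per' per using foot_per[of i 0] by simp
  have side: "dist (v i) (v (i + 1)) = f i + f (i + h)" if "i \<ge> 1" for i
  proof -
    \<comment> \<open>\<open>2 * h = n + 1\<close>, so the vertex paired with \<open>i + h\<close> is \<open>v (i + 1)\<close>\<close>
    have "i + h + h = i + 1 + n" using \<open>odd n\<close> by (auto simp: h_def elim!: oddE)
    then have "v (i + h + h) = v (i + 1)" by (simp only: per)
    then have "dist (v (i + 1)) (foot n v (i + h)) = f (i + h)"
      using dist_vertex_foot(2)[OF assms, of "i + h"] that by (simp add: f_def h_def)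
    then show ?thesis
      using dist_vertex_foot(1,3)[OF assms that] by (simp add: f_def h_def)
  qed
  have "perim n v = (\<Sum>i=1..n. f i + f (i + h))"
    unfolding perim_def by (intro sum.cong refl side) simp
  also have "\<dots> = (\<Sum>i=1..n. f i) + (\<Sum>i=1..n. f (i + h))"
    by (rule sum.distrib)
  also have "\<dots> = 2 * (\<Sum>i=1..n. f i)"
    using sum_periodic_shift[of f n h] f_per by simp
  finally show ?thesis by (simp add: f_def)
qed

end
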